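(* Let $\mathcal A$ be a first order method for which there are constants $C_0,A_0>0$ and a function $\gamma:[0,1)\to[1/2,+\infty]$ such that for every $\alpha_0\in[0,1)$, when applied to any $\mu$-strongly convex and $L$-smooth function $f$ with a gradient estimate satisfying the relative noise condition with magnitude $\alpha_0$, $\mathcal A$ (run with relative error parameter $\alpha_0$) produces $x^N$ with $$f(x^N)-f^*\le C_0LR^2\exp\left(-A_0\left(\frac\mu L\right)^{\gamma(\alpha_0)}N\right).$$ Let $f:\mathbb{R}^n\to\mathbb{R}$ be $\mu$-strongly convex and $L$-smooth, and let $\widetilde\nabla f$ satisfy the composite noise condition with parameters $\alpha\in[0,1)$ and $\delta>0$. Then for any $K>(1-\alpha)^{-1}$, using algorithm $\mathcal A$ with gradient estimate $\widetilde\nabla f$ and relative error parameter $\widehat\alpha=\alpha+\frac1K$, we can solve the problem $\min_{x}f(x)$ with precision $\varepsilon_0$, i.e. obtain $x^{N_0}$ with $$f(x^{N_0})-f^*\le\varepsilon_0=\frac{1}{(1-\alpha)^2}\left(\bigl((1+\alpha)K+1\bigr)^2+1\right)\frac{\delta^2}{\mu},$$ where $$N_0\le\frac1{A_0}\left(\frac L\mu\right)^{\gamma(\widehat\alpha)}\ln\left(\frac{(1-\alpha)^2}{\bigl((1+\alpha)K+1\bigr)^2+1}\cdot C_0\cdot LR^2\cdot\frac{\mu}{\delta^2}\right).$$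
   Context: $\|\cdot\|_2$ is the Euclidean norm; $f$ is differentiable, $x^*$ is its minimizer, $f^*=f(x^* )$, $R=\|x^0-x^*\|_2$. $L$-smooth: $f(y)\le f(x)+\langle\nabla f(x),y-x\rangle+\frac L2\|x-y\|_2^2$ for all $x,y$. $\mu$-strongly convex: $f(x)+\langle\nabla f(x),y-x\rangle+\frac\mu2\|x-y\|_2^2\le f(y)$ for all $x,y$. Relative noise condition with magnitude $\alpha_0$: $\|\widetilde\nabla f(x)-\nabla f(x)\|_2\le\alpha_0\|\nabla f(x)\|_2$ for all $x$. Composite noise condition: $\|\widetilde\nabla f(x)-\nabla f(x)\|_2\le\alpha\|\nabla f(x)\|_2+\delta$ for all $x$. A first order method with gradient estimate $\widetilde\nabla f$ is one whose iterates satisfy $x^N\in x^0+\mathrm{span}\{\widetilde\nabla f(x^0),\dots,\widetilde\nabla f(x^{N-1})\}$.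
   Formalization: The bound on N_0 is rounded up to a nonnegative integer (N_0 ≤ max(0, ⌈bound⌉)), and the claim is made only when the bound is not +∞ (γ(α̂)=∞ with positive logarithm is excluded); read literally, the claim fails in these cases. *)

theory Defs
  imports "HOL-Analysis.Analysis"
begin

section \<open>Smooth and strongly convex functions\<close>

definition grad :: "('a::euclidean_space \<Rightarrow> real) \<Rightarrow> 'a \<Rightarrow> 'a" where
  "grad f x = (THE D. GDERIV f x :> D)"

lemma grad_eqI:
  fixes f :: "'a::euclidean_space \<Rightarrow> real"
  assumes "GDERIV f x :> D"
  shows "grad f x = D"
  unfolding grad_def
proof (rule the_equality)
  show "GDERIV f x :> D" by fact
next
  fix E assume "GDERIV f x :> E"
  with assms have "(\<lambda>h. inner h E) = (\<lambda>h. inner h D)"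
    unfolding gderiv_def by (metis has_derivative_unique)
  then have "\<forall>h. inner h E = inner h D" by meson
  then show "E = D" by (simp only: vector_eq_ldot)
qed

lemma GDERIV_grad:
  fixes f :: "'a::euclidean_space \<Rightarrow> real"
  assumes "f differentiable (at x)"
  shows "GDERIV f x :> grad f x"
proof -
  obtain f' where f': "(f has_derivative f') (at x)"
    using assms unfolding differentiable_def by blast
  then have "linear f'" by (rule has_derivative_linear)
  then have "f' = (\<lambda>h. inner h (adjoint f' 1))"
    by (auto simp: adjoint_works)
  with f' have "GDERIV f x :> adjoint f' 1" unfolding gderiv_def by metis
  then show ?thesis using grad_eqI by metis
qed

definition L_smooth :: "real \<Rightarrow> ('a::euclidean_space \<Rightarrow> real) \<Rightarrow> bool" where
  "L_smooth L f \<longleftrightarrow> (\<forall>x. f differentiable (at x)) \<and>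
     (\<forall>x y. f y \<le> f x + inner (grad f x) (y - x) + L / 2 * (norm (x - y))\<^sup>2)"

definition strongly_convex :: "real \<Rightarrow> ('a::euclidean_space \<Rightarrow> real) \<Rightarrow> bool" where
  "strongly_convex \<mu> f \<longleftrightarrow> (\<forall>x. f differentiable (at x)) \<and>
     (\<forall>x y. f x + inner (grad f x) (y - x) + \<mu> / 2 * (norm (x - y))\<^sup>2 \<le> f y)"

definition minimizer :: "('a \<Rightarrow> real) \<Rightarrow> 'a \<Rightarrow> bool" where
  "minimizer f xs \<longleftrightarrow> (\<forall>y. f xs \<le> f y)"

section \<open>Noisy gradient estimates\<close>

definition relative_noise ::
    "real \<Rightarrow> ('a::euclidean_space \<Rightarrow> real) \<Rightarrow> ('a \<Rightarrow> 'a) \<Rightarrow> bool" where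
  "relative_noise \<alpha> f g \<longleftrightarrow> (\<forall>x. norm (g x - grad f x) \<le> \<alpha> * norm (grad f x))"

definition composite_noise ::
    "real \<Rightarrow> real \<Rightarrow> ('a::euclidean_space \<Rightarrow> real) \<Rightarrow> ('a \<Rightarrow> 'a) \<Rightarrow> bool" where
  "composite_noise \<alpha> \<delta> f g \<longleftrightarrow>
     (\<forall>x. norm (g x - grad f x) \<le> \<alpha> * norm (grad f x) + \<delta>)"

section \<open>First order methods\<close>

text \<open>
  A method \<open>M\<close> is given by its update rule: \<open>M \<alpha> f x0 gs\<close> is the point chosen after the
  answers \<open>gs\<close> of the gradient estimate at the previous iterates (oldest first), when \<open>M\<close> is
  run with relative error parameter \<open>\<alpha>\<close> from \<open>x0\<close>. So the \<open>N\<close>-th iterate depends on the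
  gradient estimate only through its values at the iterates \<open>0, \<dots>, N - 1\<close>. The objective
  \<open>f\<close> is an argument since the span condition does not forbid its use (e.g. line search);
  methods that use gradient estimates alone ignore it.
\<close>

type_synonym 'a grad_method = "real \<Rightarrow> ('a \<Rightarrow> real) \<Rightarrow> 'a \<Rightarrow> 'a list \<Rightarrow> 'a"

primrec answers ::
    "'a grad_method \<Rightarrow> real \<Rightarrow> ('a \<Rightarrow> real) \<Rightarrow> ('a \<Rightarrow> 'a) \<Rightarrow> 'a \<Rightarrow> nat \<Rightarrow> 'a list" where
  "answers M \<alpha> f g x0 0 = []"
| "answers M \<alpha> f g x0 (Suc N) =
     answers M \<alpha> f g x0 N @ [g (M \<alpha> f x0 (answers M \<alpha> f g x0 N))]"

definition iterate ::
    "'a grad_method \<Rightarrow> real \<Rightarrow> ('a \<Rightarrow> real) \<Rightarrow> ('a \<Rightarrow> 'a) \<Rightarrow> 'a \<Rightarrow> nat \<Rightarrow> 'a" where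
  "iterate M \<alpha> f g x0 N = M \<alpha> f x0 (answers M \<alpha> f g x0 N)"

text \<open>For \<open>N = 0\<close> the span is trivial, so the iteration starts at \<open>x0\<close>.\<close>

definition first_order_method :: "('a::euclidean_space) grad_method \<Rightarrow> bool" where
  "first_order_method M \<longleftrightarrow>
     (\<forall>\<alpha>\<in>{0..<1}. \<forall>f g x0 N.
        iterate M \<alpha> f g x0 N \<in> (+) x0 ` span ((\<lambda>k. g (iterate M \<alpha> f g x0 k)) ` {..<N}))"

section \<open>Convergence rates\<close>

text \<open>
  \<open>(\<mu> / L)\<^sup>\<gamma>\<close> and \<open>(L / \<mu>)\<^sup>\<gamma>\<close> for \<open>0 < \<mu> \<le> L\<close> and \<open>\<gamma> \<in> [1/2, \<infinity>]\<close>. The value \<open>\<gamma> = \<infinity>\<close>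
  stands for the absence of a linear rate, so the two powers are \<open>0\<close> and \<open>\<infinity>\<close> then; this is
  also how the indeterminate case \<open>\<mu> = L\<close>, \<open>\<gamma> = \<infinity>\<close> is read.
\<close>

definition rate_pow :: "real \<Rightarrow> real \<Rightarrow> ereal \<Rightarrow> real" where
  "rate_pow \<mu> L c = (if c = \<infinity> then 0 else (\<mu> / L) powr real_of_ereal c)"

definition cond_pow :: "real \<Rightarrow> real \<Rightarrow> ereal \<Rightarrow> ereal" where
  "cond_pow L \<mu> c = (if c = \<infinity> then \<infinity> else ereal ((L / \<mu>) powr real_of_ereal c))"

definition relative_noise_rate ::
    "('a::euclidean_space) grad_method \<Rightarrow> real \<Rightarrow> real \<Rightarrow> (real \<Rightarrow> ereal) \<Rightarrow> real \<Rightarrow> real \<Rightarrow> bool" where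
  "relative_noise_rate M C0 A0 \<gamma> \<mu> L \<longleftrightarrow>
     (\<forall>\<alpha>0\<in>{0..<1}. \<forall>f g x0 xs N.
        strongly_convex \<mu> f \<longrightarrow> L_smooth L f \<longrightarrow> relative_noise \<alpha>0 f g \<longrightarrow> minimizer f xs \<longrightarrow>
        f (iterate M \<alpha>0 f g x0 N) - f xs
          \<le> C0 * L * (norm (x0 - xs))\<^sup>2 * exp (- A0 * rate_pow \<mu> L (\<gamma> \<alpha>0) * real N))"

end

theory Submission
  imports Defs
begin

text \<open>
  Where \<open>\<parallel>\<nabla>f\<parallel> \<ge> K\<delta>\<close>, composite noise with parameters \<open>\<alpha>, \<delta>\<close> is relative noise of magnitude
  \<open>\<alpha> + 1/K\<close>. Replace the estimate by the exact gradient elsewhere: the new estimate has relative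
  noise everywhere, and the method cannot tell the two apart until some iterate satisfies
  \<open>\<parallel>\<nabla>f\<parallel> < K\<delta>\<close>. If that happens early enough, the gradient-dominance inequality
  \<open>f x - f* \<le> \<parallel>\<nabla>f x\<parallel>\<^sup>2 / (2\<mu>)\<close> gives the precision at that iterate; otherwise the
  convergence rate under relative noise gives it at the last one.
\<close>

text \<open>Cauchy-Schwarz turns strong convexity into a bound by a concave quadratic in the
  distance from \<open>x\<close> to \<open>y\<close>; completing the square bounds that quadratic by
  its maximum.\<close>

lemma strongly_convex_gap_le:
  assumes sc: "strongly_convex \<mu> f" and \<mu>: "0 < \<mu>"
  shows "f x - f y \<le> (norm (grad f x))\<^sup>2 / (2 * \<mu>)"
proof -
  let ?d = "norm (x - y)" and ?G = "norm (grad f x)"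
  have "f x + inner (grad f x) (y - x) + \<mu> / 2 * ?d\<^sup>2 \<le> f y"
    using sc unfolding strongly_convex_def by blast
  moreover have "- inner (grad f x) (y - x) \<le> ?G * ?d"
    using norm_cauchy_schwarz[of "grad f x" "x - y"] by (simp add: inner_diff_right)
  ultimately have gap: "f x - f y \<le> ?G * ?d - \<mu> / 2 * ?d\<^sup>2" by linarith
  have "0 \<le> (?G - \<mu> * ?d)\<^sup>2 / (2 * \<mu>)" using \<mu> by simp
  also have "\<dots> = ?G\<^sup>2 / (2 * \<mu>) - (?G * ?d - \<mu> / 2 * ?d\<^sup>2)"
    using \<mu> by (simp add: field_simps power2_eq_square)
  finally show ?thesis using gap by linarith
qed

text \<open>The two quadratic bounds are compared between 0 and a unit vector. This yields the
  positivity of \<open>L\<close> from that of \<open>\<mu>\<close>.\<close>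

lemma strongly_convex_L_smooth_le:
  fixes f :: "'a::euclidean_space \<Rightarrow> real"
  assumes sc: "strongly_convex \<mu> f" and sm: "L_smooth L f"
  shows "\<mu> \<le> L"
proof -
  obtain b :: 'a where "b \<in> Basis" using nonempty_Basis by blast
  then have b: "norm b = 1" by simp
  have "f 0 + inner (grad f 0) (b - 0) + \<mu> / 2 * (norm (0 - b))\<^sup>2 \<le> f b"
    using sc unfolding strongly_convex_def by blast
  moreover have "f b \<le> f 0 + inner (grad f 0) (b - 0) + L / 2 * (norm (0 - b))\<^sup>2"
    using sm unfolding L_smooth_def by blast
  ultimately show ?thesis by (simp add: b)
qed

text \<open>Agreement is asked only along the run with \<open>g\<close>: by induction the run with
  \<open>g'\<close> visits the same points.\<close>

lemma answers_cong:
  assumes "\<And>k. k < N \<Longrightarrow> g' (iterate M \<alpha> f g x0 k) = g (iterate M \<alpha> f g x0 k)"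
  shows "answers M \<alpha> f g' x0 N = answers M \<alpha> f g x0 N"
  using assms by (induction N) (simp_all add: iterate_def)

lemma composite_noise_imp_relative_noise:
  assumes noise: "composite_noise \<alpha> \<delta> f g" and "0 \<le> \<alpha>" and "0 < K"
  shows "relative_noise (\<alpha> + 1 / K) f
           (\<lambda>x. if K * \<delta> \<le> norm (grad f x) then g x else grad f x)"
  unfolding relative_noise_def
proof
  fix x
  let ?g = "\<lambda>x. if K * \<delta> \<le> norm (grad f x) then g x else grad f x"
  show "norm (?g x - grad f x) \<le> (\<alpha> + 1 / K) * norm (grad f x)"
  proof (cases "K * \<delta> \<le> norm (grad f x)")
    case True
    then have "\<delta> \<le> norm (grad f x) / K" using \<open>0 < K\<close> by (simp add: field_simps)
    moreover have "norm (g x - grad f x) \<le> \<alpha> * norm (grad f x) + \<delta>"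
      using noise unfolding composite_noise_def by blast
    ultimately show ?thesis using True by (simp add: distrib_right)
  next
    case False
    then show ?thesis using assms by simp
  qed
qed

text \<open>
  If the bound on the number of steps is \<open>-\<infinity>\<close>, then \<^const>\<open>real_of_ereal\<close> turns it into \<open>0\<close>, which
  is harmless since \<open>ln c < 0\<close>. For \<open>c = 0\<close> the junk value \<open>ln 0 = 0\<close> is harmless too.
\<close>

lemma le_exp_rate_pow:
  fixes c A0 \<mu> L :: real and e :: ereal
  defines "B \<equiv> ereal (1 / A0) * cond_pow L \<mu> e * ereal (ln c)"
  assumes "0 \<le> c" "0 < A0" "0 < \<mu>" "0 < L" "B < \<infinity>"
  shows "c \<le> exp (A0 * rate_pow \<mu> L e * real (nat \<lceil>real_of_ereal B\<rceil>))" (is "_ \<le> exp (_ * real ?N)")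
proof (cases "c \<le> 1")
  case True
  moreover have "0 \<le> A0 * rate_pow \<mu> L e * real ?N"
    using assms by (simp add: rate_pow_def)
  then have "1 \<le> exp (A0 * rate_pow \<mu> L e * real ?N)" by simp
  ultimately show ?thesis by linarith
next
  case False
  then have ln: "0 < ln c" by simp
  have "e \<noteq> \<infinity>"
  proof
    assume "e = \<infinity>"
    then have "B = \<infinity>" using ln \<open>0 < A0\<close> by (simp add: B_def cond_pow_def)
    then show False using \<open>B < \<infinity>\<close> by simp
  qed
  define r where "r = real_of_ereal e"
  have "B = ereal (1 / A0 * (L / \<mu>) powr r * ln c)"
    using \<open>e \<noteq> \<infinity>\<close> by (simp add: B_def cond_pow_def r_def)
  then have "1 / A0 * (L / \<mu>) powr r * ln c \<le> real ?N"
    by (simp add: real_nat_ceiling_ge)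
  \<comment> \<open>The factor \<open>A0 * (\<mu> / L) powr r\<close> is the reciprocal of the
    coefficient of \<open>ln c\<close> in \<open>B\<close>, so it turns the lower bound on the step
    count into \<open>ln c\<close>.\<close>
  then have "A0 * (\<mu> / L) powr r * (1 / A0 * (L / \<mu>) powr r * ln c) \<le> A0 * (\<mu> / L) powr r * real ?N"
    using \<open>0 < A0\<close> by (intro mult_left_mono) auto
  moreover have "(\<mu> / L) powr r * (L / \<mu>) powr r = 1"
    using \<open>0 < \<mu>\<close> \<open>0 < L\<close> by (simp flip: powr_mult)
  then have "A0 * (\<mu> / L) powr r * (1 / A0 * (L / \<mu>) powr r * ln c) = ln c"
    using \<open>0 < A0\<close> by (simp add: mult.assoc[symmetric])
  ultimately have "ln c \<le> A0 * rate_pow \<mu> L e * real ?N"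
    using \<open>e \<noteq> \<infinity>\<close> by (simp add: rate_pow_def r_def)
  then have "exp (ln c) \<le> exp (A0 * rate_pow \<mu> L e * real ?N)" by (simp only: exp_le_cancel_iff)
  then show ?thesis using False by simp
qed

text \<open>Keeping \<open>\<epsilon>\<close> and \<open>N\<close> arbitrary separates the
  comparison of the two runs from the arithmetic: \<open>small\<close> serves an early stop,
  \<open>steps\<close> a full run.\<close>

lemma gap_le_of_composite_noise:
  assumes rate: "relative_noise_rate M C0 A0 \<gamma> \<mu> L" and \<mu>: "0 < \<mu>"
    and sc: "strongly_convex \<mu> f" and sm: "L_smooth L f" and min: "minimizer f xs"
    and noise: "composite_noise \<alpha> \<delta> f g" and "0 \<le> \<alpha>" "0 \<le> \<delta>" "0 < K" "\<alpha> + 1 / K < 1"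
    and small: "(K * \<delta>)\<^sup>2 / (2 * \<mu>) \<le> \<epsilon>"
    and steps: "C0 * L * (norm (x0 - xs))\<^sup>2 * exp (- A0 * rate_pow \<mu> L (\<gamma> (\<alpha> + 1 / K)) * real N) \<le> \<epsilon>"
  shows "\<exists>n\<le>N. f (iterate M (\<alpha> + 1 / K) f g x0 n) - f xs \<le> \<epsilon>"
proof (cases "\<exists>k<N. norm (grad f (iterate M (\<alpha> + 1 / K) f g x0 k)) < K * \<delta>")
  case True
  then obtain k where k: "k < N" "norm (grad f (iterate M (\<alpha> + 1 / K) f g x0 k)) < K * \<delta>"
    by blast
  let ?x = "iterate M (\<alpha> + 1 / K) f g x0 k"
  have "f ?x - f xs \<le> (norm (grad f ?x))\<^sup>2 / (2 * \<mu>)"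
    using sc \<mu> by (rule strongly_convex_gap_le)
  also have "\<dots> \<le> (K * \<delta>)\<^sup>2 / (2 * \<mu>)"
    using k \<mu> by (intro divide_right_mono power_mono) auto
  finally show ?thesis using k small by (intro exI[of _ k]) auto
next
  case False
  let ?g = "\<lambda>x. if K * \<delta> \<le> norm (grad f x) then g x else grad f x"
  \<comment> \<open>Iterate \<open>N\<close> depends only on the answers at iterates
    \<open>0\<close> to \<open>N - 1\<close>, so the failure of the case condition for
    \<open>k < N\<close> suffices, whatever the gradient at iterate \<open>N\<close>.\<close>
  have same: "iterate M (\<alpha> + 1 / K) f ?g x0 N = iterate M (\<alpha> + 1 / K) f g x0 N"
    unfolding iterate_def
    by (subst answers_cong[where g = g]) (use False in force, simp)
  have "\<alpha> + 1 / K \<in> {0..<1}" using assms by simp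
  moreover have "relative_noise (\<alpha> + 1 / K) f ?g"
    using noise \<open>0 \<le> \<alpha>\<close> \<open>0 < K\<close> by (rule composite_noise_imp_relative_noise)
  ultimately have "f (iterate M (\<alpha> + 1 / K) f ?g x0 N) - f xs
      \<le> C0 * L * (norm (x0 - xs))\<^sup>2 * exp (- A0 * rate_pow \<mu> L (\<gamma> (\<alpha> + 1 / K)) * real N)"
    using rate sc sm min unfolding relative_noise_rate_def by blast
  then show ?thesis using steps unfolding same by (intro exI[of _ N]) auto
qed

theorem theorem9p1:
  fixes M :: "(real ^ 'n) grad_method"
    and C0 A0 \<mu> L \<alpha> \<delta> K \<epsilon>0 :: real
    and \<gamma> :: "real \<Rightarrow> ereal"
    and f :: "real ^ 'n \<Rightarrow> real"
    and g :: "real ^ 'n \<Rightarrow> real ^ 'n"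
    and x0 xs :: "real ^ 'n"
    and B :: ereal
  assumes "0 < \<mu>"
    and "first_order_method M"
    and "0 < C0" and "0 < A0"
    and "\<And>a. a \<in> {0..<1} \<Longrightarrow> 1 / 2 \<le> \<gamma> a"
    and "relative_noise_rate M C0 A0 \<gamma> \<mu> L"
    and "strongly_convex \<mu> f" and "L_smooth L f"
    and "minimizer f xs"
    and "0 \<le> \<alpha>" and "\<alpha> < 1" and "0 < \<delta>"
    and "composite_noise \<alpha> \<delta> f g"
    and "K > 1 / (1 - \<alpha>)"
    and "\<epsilon>0 = 1 / (1 - \<alpha>)\<^sup>2 * (((1 + \<alpha>) * K + 1)\<^sup>2 + 1) * (\<delta>\<^sup>2 / \<mu>)"
    and "B = ereal (1 / A0) * cond_pow L \<mu> (\<gamma> (\<alpha> + 1 / K))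
              * ereal (ln ((1 - \<alpha>)\<^sup>2 / (((1 + \<alpha>) * K + 1)\<^sup>2 + 1)
                           * C0 * (L * (norm (x0 - xs))\<^sup>2) * (\<mu> / \<delta>\<^sup>2)))"
  shows "B < \<infinity> \<longrightarrow>
    (\<exists>N0. N0 \<le> nat \<lceil>real_of_ereal B\<rceil> \<and> f (iterate M (\<alpha> + 1 / K) f g x0 N0) - f xs \<le> \<epsilon>0)"
proof
  assume B: "B < \<infinity>"
  let ?Q = "((1 + \<alpha>) * K + 1)\<^sup>2 + 1"
  let ?R = "norm (x0 - xs)"
  let ?c = "(1 - \<alpha>)\<^sup>2 / ?Q * C0 * (L * ?R\<^sup>2) * (\<mu> / \<delta>\<^sup>2)"
  let ?N = "nat \<lceil>real_of_ereal B\<rceil>"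
  have "0 < 1 / (1 - \<alpha>)" using \<open>\<alpha> < 1\<close> by simp
  then have K: "0 < K" using \<open>K > 1 / (1 - \<alpha>)\<close> by linarith
  \<comment> \<open>This is the lower bound on \<open>K\<close> rearranged; it makes
    \<open>\<alpha> + 1 / K\<close> an admissible relative error.\<close>
  have K1: "\<alpha> + 1 / K < 1" using K \<open>K > 1 / (1 - \<alpha>)\<close> \<open>\<alpha> < 1\<close> by (simp add: field_simps)
  have Q: "0 < ?Q" by (simp add: add_nonneg_pos)
  have L: "0 < L"
    using strongly_convex_L_smooth_le[of \<mu> f L] \<open>strongly_convex \<mu> f\<close> \<open>L_smooth L f\<close> \<open>0 < \<mu>\<close> by simp
  have \<epsilon>: "0 < \<epsilon>0" using assms(15) Q \<open>\<alpha> < 1\<close> \<open>0 < \<delta>\<close> \<open>0 < \<mu>\<close> by simp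
  \<comment> \<open>The early-stop gap is governed by \<open>K\<^sup>2\<close>, which the larger
    constant in \<open>\<epsilon>0\<close> dominates.\<close>
  have "K\<^sup>2 \<le> ((1 + \<alpha>) * K + 1)\<^sup>2"
  proof (rule power_mono)
    have "0 \<le> \<alpha> * K" using \<open>0 \<le> \<alpha>\<close> K by simp
    then show "K \<le> (1 + \<alpha>) * K + 1" by (simp add: algebra_simps)
  qed (use K in simp)
  also have "\<dots> \<le> ?Q" by simp
  also have "\<dots> \<le> 1 / (1 - \<alpha>)\<^sup>2 * ?Q"
  proof -
    have "1 \<le> 1 / (1 - \<alpha>)\<^sup>2" using \<open>0 \<le> \<alpha>\<close> \<open>\<alpha> < 1\<close> by (simp add: power_le_one)
    then show ?thesis using Q mult_right_mono[of 1 "1 / (1 - \<alpha>)\<^sup>2" ?Q] by simp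
  qed
  finally have "K\<^sup>2 * (\<delta>\<^sup>2 / \<mu>) \<le> \<epsilon>0"
    unfolding assms(15) using \<open>0 < \<mu>\<close> by (intro mult_right_mono) auto
  moreover have "(K * \<delta>)\<^sup>2 / (2 * \<mu>) \<le> K\<^sup>2 * (\<delta>\<^sup>2 / \<mu>)"
    using \<open>0 < \<mu>\<close> by (simp add: power_mult_distrib field_simps)
  ultimately have small: "(K * \<delta>)\<^sup>2 / (2 * \<mu>) \<le> \<epsilon>0" by linarith
  \<comment> \<open>Here \<open>?c\<close> is the ratio of \<open>C0 * L * ?R\<^sup>2\<close> to
    \<open>\<epsilon>0\<close>, so this says that the guaranteed rate has reached
    \<open>\<epsilon>0\<close> after \<open>?N\<close> steps.\<close>
  have "?c \<le> exp (A0 * rate_pow \<mu> L (\<gamma> (\<alpha> + 1 / K)) * real ?N)"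
    unfolding assms(16)
  proof (rule le_exp_rate_pow)
    \<comment> \<open>The inequality is not strict: \<open>?c\<close> vanishes when
      \<open>x0 = xs\<close>.\<close>
    show "0 \<le> ?c" using \<open>0 < C0\<close> L \<open>0 < \<mu>\<close> Q by simp
  qed (use B assms(16) L \<open>0 < A0\<close> \<open>0 < \<mu>\<close> in auto)
  moreover have "x * exp (- t) \<le> 1" if "x \<le> exp t" for x t :: real
    using that by (simp add: exp_minus field_simps)
  ultimately have "?c * exp (- (A0 * rate_pow \<mu> L (\<gamma> (\<alpha> + 1 / K)) * real ?N)) \<le> 1"
    by blast
  then have "?c * exp (- A0 * rate_pow \<mu> L (\<gamma> (\<alpha> + 1 / K)) * real ?N) \<le> 1"
    by (simp only: mult_minus_left)
  then have "\<epsilon>0 * ?c * exp (- A0 * rate_pow \<mu> L (\<gamma> (\<alpha> + 1 / K)) * real ?N) \<le> \<epsilon>0"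
    unfolding mult.assoc[of \<epsilon>0] by (rule mult_left_le) (use \<epsilon> in simp)
  moreover have "\<epsilon>0 * ?c = C0 * L * ?R\<^sup>2"
    unfolding assms(15) using \<open>\<alpha> < 1\<close> \<open>0 < \<mu>\<close> \<open>0 < \<delta>\<close> Q by simp
  ultimately have
    "C0 * L * ?R\<^sup>2 * exp (- A0 * rate_pow \<mu> L (\<gamma> (\<alpha> + 1 / K)) * real ?N) \<le> \<epsilon>0"
    by (simp only:)
  with \<open>relative_noise_rate M C0 A0 \<gamma> \<mu> L\<close> \<open>0 < \<mu>\<close> \<open>strongly_convex \<mu> f\<close> \<open>L_smooth L f\<close>
    \<open>minimizer f xs\<close> \<open>composite_noise \<alpha> \<delta> f g\<close> \<open>0 \<le> \<alpha>\<close> less_imp_le[OF \<open>0 < \<delta>\<close>] K K1 small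
  show "\<exists>N0. N0 \<le> ?N \<and> f (iterate M (\<alpha> + 1 / K) f g x0 N0) - f xs \<le> \<epsilon>0"
    by (rule gap_le_of_composite_noise)
qed

end
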